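(* Let $p=p(n)\in[0,1]$ and let $\lambda(n,p)=(n+1)!\,(1-p)^n$. Let $\operatorname{Perm}(n)_p$ denote the random subgraph of the $n$-dimensional permutahedron obtained by keeping each edge independently with probability $p$. Then \[\lim_{n\to\infty}\mathbb{P}(\operatorname{Perm}(n)_p\text{ is connected})=\begin{cases}0&\text{if }\lambda(n,p)\to\infty;\\ e^{-c}&\text{if }\lambda(n,p)\to c\ge 0.\end{cases}\]
   Context: The $n$-dimensional permutahedron $\operatorname{Perm}(n)$ is the graph with vertex set the symmetric group $S_{n+1}$ and edge set $\{\{\pi,\tau_i\pi\}:\pi\in S_{n+1},\,1\le i\le n\}$, where $\tau_i$ is the transposition $(i,i+1)$ and $(\sigma\pi)(j)=\sigma(\pi(j))$. *)

theory Defs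
  imports "HOL-Probability.Probability" "HOL-Combinatorics.Permutations"
    "Graph_Theory.Digraph_Component"
begin

definition permutahedron_verts :: "nat \<Rightarrow> (nat \<Rightarrow> nat) set" where
  "permutahedron_verts n = {\<pi>. \<pi> permutes {1..n + 1}}"

definition permutahedron_edges :: "nat \<Rightarrow> (nat \<Rightarrow> nat) set set" where
  "permutahedron_edges n =
     {{\<pi>, Transposition.transpose i (i + 1) \<circ> \<pi>} | \<pi> i.
        \<pi> \<in> permutahedron_verts n \<and> i \<in> {1..n}}"

text \<open>Every undirected edge \<open>{u, v}\<close> is represented by the two arcs \<open>(u, v)\<close> and \<open>(v, u)\<close>.\<close>

definition undirected_graph :: "'a set \<Rightarrow> 'a set set \<Rightarrow> 'a pair_pre_digraph" where
  "undirected_graph V E = \<lparr>pverts = V, parcs = {(u, v). {u, v} \<in> E}\<rparr>"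

definition permutahedron :: "nat \<Rightarrow> (nat \<Rightarrow> nat) pair_pre_digraph" where
  "permutahedron n = undirected_graph (permutahedron_verts n) (permutahedron_edges n)"

text \<open>
  The coin flips are indexed by the undirected edges, so the two arcs of an edge are kept or
  deleted together. All vertices are kept.
\<close>

definition random_permutahedron ::
    "nat \<Rightarrow> real \<Rightarrow> (nat \<Rightarrow> nat) pair_pre_digraph pmf" where
  "random_permutahedron n p =
     map_pmf (\<lambda>keep. undirected_graph (permutahedron_verts n) {e \<in> permutahedron_edges n. keep e})
       (Pi_pmf (permutahedron_edges n) False (\<lambda>_. bernoulli_pmf p))"

definition permutahedron_lambda :: "nat \<Rightarrow> real \<Rightarrow> real" where
  "permutahedron_lambda n p = fact (n + 1) * (1 - p) ^ n"

text \<open>\<^const>\<open>Pi_pmf\<close> is the product distribution only for finite index sets.\<close>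

lemma finite_permutahedron_verts: "finite (permutahedron_verts n)"
  by (simp add: permutahedron_verts_def finite_permutations)

lemma finite_permutahedron_edges: "finite (permutahedron_edges n)"
proof -
  have "permutahedron_edges n \<subseteq>
      (\<lambda>(\<pi>, i). {\<pi>, Transposition.transpose i (i + 1) \<circ> \<pi>}) ` (permutahedron_verts n \<times> {1..n})"
    unfolding permutahedron_edges_def by auto
  then show ?thesis
    by (rule finite_subset) (simp add: finite_permutahedron_verts)
qed

text \<open>The permutahedron is a simple graph, and deleting no edge gives it back.\<close>

lemma permutahedron_edge:
  assumes "e \<in> permutahedron_edges n"
  shows "e \<subseteq> permutahedron_verts n" "card e = 2"
proof -
  obtain \<pi> i where e: "e = {\<pi>, Transposition.transpose i (i + 1) \<circ> \<pi>}"
    and \<pi>: "\<pi> permutes {1..n + 1}" and i: "1 \<le> i" "i \<le> n"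
    using assms by (auto simp: permutahedron_edges_def permutahedron_verts_def)
  have "Transposition.transpose i (i + 1) permutes {1..n + 1}"
    using i by (intro permutes_swap_id) auto
  then show "e \<subseteq> permutahedron_verts n"
    using \<pi> by (auto simp: e permutahedron_verts_def intro: permutes_compose)
  obtain x where "\<pi> x = i"
    using permutes_surj[OF \<pi>] by (metis surjD)
  then have "(Transposition.transpose i (i + 1) \<circ> \<pi>) x \<noteq> \<pi> x"
    by simp
  then have "\<pi> \<noteq> Transposition.transpose i (i + 1) \<circ> \<pi>"
    by metis
  then show "card e = 2"
    by (simp add: e)
qed

lemma random_permutahedron_1: "random_permutahedron n 1 = return_pmf (permutahedron n)"
proof -
  have "bernoulli_pmf 1 = return_pmf True"
    by (rule pmf_eqI) (auto simp: pmf_return indicator_def split: bool.splits)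
  moreover have "{e \<in> permutahedron_edges n. e \<in> permutahedron_edges n} = permutahedron_edges n"
    by blast
  ultimately show ?thesis
    by (simp add: random_permutahedron_def permutahedron_def finite_permutahedron_edges cong: conj_cong)
qed

end

theory Submission
  imports Defs "HOL-Real_Asymp.Real_Asymp"
begin

text \<open>
  Write \<open>q = 1 - p\<close>. If \<open>\<lambda> \<rightarrow> \<infinity>\<close>, look only at permutations of one parity: no two of them are
  adjacent, so they are isolated independently of each other, and the probability that none of
  them is isolated is at most \<open>exp (- \<lambda> / 2)\<close>.

  Let \<open>\<lambda> \<rightarrow> c\<close>, so that \<open>q \<rightarrow> 0\<close>. Revealing the vertices one at a time, being isolated is
  independent of what happens away from the neighbours, whence the probability that no vertex is
  isolated differs from \<open>(1 - q^n)^(n+1)!\<close>, and thus from \<open>exp (- \<lambda>)\<close>, by \<open>o(\<lambda>)\<close>.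

  It remains to see that isolated vertices are the only obstruction. Call a vertex poor if more than
  three quarters of its edges are deleted. With high probability no two adjacent vertices are poor,
  and two vertices \<open>\<tau>\<^sub>a x\<close>, \<open>\<tau>\<^sub>b x\<close> that are not poor are always linked: commutation of distant
  adjacent transpositions gives quadratically many short walks between them, and deleting that many
  edges locally is too unlikely for \<open>(n+1)!\<close> vertices to matter. A poor vertex \<open>u\<close> that is not
  isolated has a kept edge to some \<open>\<tau>\<^sub>a u\<close>, which is linked to every other neighbour of \<open>u\<close>. So all
  edges of the permutahedron join linked vertices.
\<close>

section \<open>Random subsets\<close>

lemma prob_pair_pmf_Times:
  "measure_pmf.prob (pair_pmf M N) (A \<times> B) = measure_pmf.prob M A * measure_pmf.prob N B"
proof -
  have "measure_pmf.prob (pair_pmf M N) (A \<times> B) =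
      measure_pmf.prob (pair_pmf M N) ((A \<times> B) \<inter> set_pmf (pair_pmf M N))"
    by (rule measure_Int_set_pmf[symmetric])
  also have "(A \<times> B) \<inter> set_pmf (pair_pmf M N) = (A \<inter> set_pmf M) \<times> (B \<inter> set_pmf N)"
    by auto
  also have "measure_pmf.prob (pair_pmf M N) \<dots> =
      measure_pmf.prob M (A \<inter> set_pmf M) * measure_pmf.prob N (B \<inter> set_pmf N)"
    by (intro measure_pmf_prob_product countable_Int2) simp_all
  finally show ?thesis
    by (simp add: measure_Int_set_pmf)
qed

lemma prob_UNION_le_card:
  fixes c :: real
  assumes "finite I" "\<And>i. i \<in> I \<Longrightarrow> measure_pmf.prob M (A i) \<le> c"
  shows "measure_pmf.prob M (\<Union>i\<in>I. A i) \<le> card I * c"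
proof -
  have "measure_pmf.prob M (\<Union>i\<in>I. A i) \<le> (\<Sum>i\<in>I. measure_pmf.prob M (A i))"
    using assms(1) by (intro measure_UNION_le) auto
  also have "\<dots> \<le> card I * c"
    using assms(2) by (rule sum_bounded_above)
  finally show ?thesis .
qed

definition random_subset :: "'a set \<Rightarrow> real \<Rightarrow> 'a set pmf" where
  "random_subset E p = map_pmf (\<lambda>keep. {e \<in> E. keep e}) (Pi_pmf E False (\<lambda>_. bernoulli_pmf p))"

lemma prob_random_subset_mono:
  assumes "\<And>F. F \<subseteq> E \<Longrightarrow> F \<in> A \<Longrightarrow> F \<in> B"
  shows "measure_pmf.prob (random_subset E p) A \<le> measure_pmf.prob (random_subset E p) B"
proof -
  have "set_pmf (random_subset E p) \<subseteq> Pow E"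
    by (auto simp: random_subset_def)
  then have "A \<inter> set_pmf (random_subset E p) \<subseteq> B"
    using assms by blast
  then have "measure_pmf.prob (random_subset E p) (A \<inter> set_pmf (random_subset E p)) \<le>
      measure_pmf.prob (random_subset E p) B"
    by (intro measure_pmf.finite_measure_mono) auto
  then show ?thesis
    by (simp add: measure_Int_set_pmf)
qed

lemma prob_random_subset_disjoint_inter:
  assumes "finite E" "p \<in> {0..1}" "A \<subseteq> E" and Q: "\<And>F. Q (F - A) = Q F"
  shows "measure_pmf.prob (random_subset E p) {F. A \<inter> F = {} \<and> Q F} =
    (1 - p) ^ card A * measure_pmf.prob (random_subset E p) {F. Q F}"
proof -
  let ?coins = "\<lambda>A. Pi_pmf A False (\<lambda>_. bernoulli_pmf p)"
  define merge where "merge = (\<lambda>(f, g) e. if e \<in> A then f e else g e :: bool)"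
  have "finite A"
    using assms finite_subset by blast
  have "?coins E = ?coins (A \<union> (E - A))"
    using assms(3) by (simp add: Un_absorb1)
  also have "\<dots> = map_pmf merge (pair_pmf (?coins A) (?coins (E - A)))"
    unfolding merge_def using \<open>finite A\<close> assms(1) by (intro Pi_pmf_union) auto
  finally have coins: "?coins E = \<dots>" .
  have "{e \<in> E. merge (f, g) e} - A = {e \<in> E. g e} - A" for f g
    by (auto simp: merge_def)
  then have "Q {e \<in> E. merge (f, g) e} \<longleftrightarrow> Q {e \<in> E. g e}" for f g
    by (metis Q)
  moreover have "A \<inter> {e \<in> E. merge (f, g) e} = {} \<longleftrightarrow> f \<in> Pi A (\<lambda>_. {False})" for f g
    using assms(3) by (auto simp: merge_def)
  ultimately have
    "merge -` (\<lambda>keep. {e \<in> E. keep e}) -` {F. Q F} = UNIV \<times> {g. Q {e \<in> E. g e}}"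
    "merge -` (\<lambda>keep. {e \<in> E. keep e}) -` {F. A \<inter> F = {} \<and> Q F} =
      Pi A (\<lambda>_. {False}) \<times> {g. Q {e \<in> E. g e}}"
    by (simp_all add: vimage_def split_paired_all set_eq_iff[of "Collect _"])
  moreover have "measure_pmf.prob (?coins A) (Pi A (\<lambda>_. {False})) = (1 - p) ^ card A"
    using \<open>finite A\<close> assms(2) by (simp add: measure_Pi_pmf_Pi measure_pmf_single)
  ultimately show ?thesis
    unfolding random_subset_def measure_map_pmf coins by (simp only: prob_pair_pmf_Times) simp
qed

corollary prob_random_subset_disjoint:
  assumes "finite E" "p \<in> {0..1}" "A \<subseteq> E"
  shows "measure_pmf.prob (random_subset E p) {F. A \<inter> F = {}} = (1 - p) ^ card A"
  using prob_random_subset_disjoint_inter[OF assms, of "\<lambda>_. True"] by simp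

lemma prob_random_subset_card_Diff_ge:
  assumes "finite E" "p \<in> {0..1}" "A \<subseteq> E" "card A \<le> N"
  shows "measure_pmf.prob (random_subset E p) {F. m \<le> card (A - F)} \<le> 2 ^ N * (1 - p) ^ m"
proof -
  have "finite A"
    using assms finite_subset by blast
  let ?S = "{B \<in> Pow A. card B = m}"
  have "{F. m \<le> card (A - F)} \<subseteq> (\<Union>B\<in>?S. {F. B \<inter> F = {}})"
  proof
    fix F assume "F \<in> {F. m \<le> card (A - F)}"
    then obtain B where "B \<subseteq> A - F" "card B = m"
      using obtain_subset_with_card_n[of m "A - F"] by auto
    then show "F \<in> (\<Union>B\<in>?S. {F. B \<inter> F = {}})"
      by auto
  qed
  then have "measure_pmf.prob (random_subset E p) {F. m \<le> card (A - F)} \<le>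
      measure_pmf.prob (random_subset E p) (\<Union>B\<in>?S. {F. B \<inter> F = {}})"
    by (intro measure_pmf.finite_measure_mono) auto
  also have "\<dots> \<le> card ?S * (1 - p) ^ m"
    using \<open>finite A\<close> assms by (intro prob_UNION_le_card) (auto simp: prob_random_subset_disjoint)
  also have "\<dots> \<le> 2 ^ N * (1 - p) ^ m"
  proof (rule mult_right_mono)
    have "card ?S \<le> card (Pow A)"
      using \<open>finite A\<close> by (intro card_mono) auto
    also have "\<dots> \<le> 2 ^ N"
      using \<open>finite A\<close> assms(4) by (simp add: card_Pow)
    finally show "real (card ?S) \<le> 2 ^ N"
      by (simp add: numeral_power_le_of_nat_cancel_iff)
  qed (use assms in auto)
  finally show ?thesis .
qed

section \<open>Finite graphs\<close>

definition linked :: "'a set set \<Rightarrow> 'a \<Rightarrow> 'a \<Rightarrow> bool" where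
  "linked F u v \<longleftrightarrow> (u, v) \<in> {(x, y). {x, y} \<in> F}\<^sup>*"

lemma linked_refl [simp]: "linked F u u"
  by (simp add: linked_def)

lemma linked_edge: "{u, v} \<in> F \<Longrightarrow> linked F u v"
  by (auto simp: linked_def)

lemma linked_trans [trans]: "linked F u v \<Longrightarrow> linked F v w \<Longrightarrow> linked F u w"
  unfolding linked_def by (rule rtrancl_trans)

lemma linked_sym: "linked F u v \<Longrightarrow> linked F v u"
proof -
  have "sym {(x, y). {x, y} \<in> F}"
    by (auto simp: insert_commute intro: symI)
  then show "linked F u v \<Longrightarrow> linked F v u"
    unfolding linked_def by (metis sym_rtrancl symE)
qed

definition all_linked :: "'a set \<Rightarrow> 'a set set \<Rightarrow> bool" where
  "all_linked V F \<longleftrightarrow> (\<forall>u\<in>V. \<forall>v\<in>V. linked F u v)"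

lemma connected_undirected_graph_iff:
  assumes "\<And>e. e \<in> F \<Longrightarrow> e \<subseteq> V" "V \<noteq> {}"
  shows "Digraph_Component.connected (with_proj (undirected_graph V F)) \<longleftrightarrow> all_linked V F"
proof -
  let ?G = "undirected_graph V F"
  interpret pair_wf_digraph ?G
    by unfold_locales (use assms(1) in \<open>fastforce simp: undirected_graph_def\<close>)+
  have "symmetric (with_proj ?G)"
    by (auto simp: symmetric_def undirected_graph_def insert_commute intro: symI)
  then have "u \<rightarrow>\<^sup>*\<^bsub>mk_symmetric ?G\<^esub> v \<longleftrightarrow> u \<in> V \<and> v \<in> V \<and> linked F u v" for u v
    using reachable_mk_symmetric_eq[of u v] reachable_conv[of u v]
    by (auto simp: undirected_graph_def linked_def)
  then show ?thesis
    using assms(2)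
    by (auto simp: Digraph_Component.connected_def strongly_connected_def undirected_graph_def
        all_linked_def)
qed

definition incident_edges :: "'a set set \<Rightarrow> 'a \<Rightarrow> 'a set set" where
  "incident_edges E v = {e \<in> E. v \<in> e}"

definition neighbours :: "'a set set \<Rightarrow> 'a \<Rightarrow> 'a set" where
  "neighbours E v = {w. {v, w} \<in> E}"

lemma incident_edges_subset [simp]: "incident_edges E v \<subseteq> E"
  by (auto simp: incident_edges_def)

locale finite_graph =
  fixes V :: "'a set" and E :: "'a set set"
  assumes finite_verts: "finite V"
    and edge_subset: "e \<in> E \<Longrightarrow> e \<subseteq> V"
    and card_edge: "e \<in> E \<Longrightarrow> card e = 2"
begin

definition isolated :: "'a set set \<Rightarrow> 'a \<Rightarrow> bool" where
  "isolated F v \<longleftrightarrow> incident_edges E v \<inter> F = {}"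

definition none_isolated :: "'a set \<Rightarrow> 'a set set set" where
  "none_isolated U = {F. \<forall>v\<in>U. \<not> isolated F v}"

lemma finite_edges: "finite E"
  using finite_verts edge_subset by (intro finite_subset[of E "Pow V"]) auto

lemma finite_incident_edges: "finite (incident_edges E v)"
  using incident_edges_subset finite_edges by (rule finite_subset)

lemma neighbours_subset: "neighbours E v \<subseteq> V"
  using edge_subset by (auto simp: neighbours_def)

lemma finite_neighbours: "finite (neighbours E v)"
  using neighbours_subset finite_verts by (rule finite_subset)

lemma not_neighbour_self: "v \<notin> neighbours E v"
  using card_edge[of "{v, v}"] by (auto simp: neighbours_def)

lemma card_neighbours: "card (neighbours E v) = card (incident_edges E v)"
proof (rule bij_betw_same_card)
  have "e \<in> (\<lambda>w. {v, w}) ` neighbours E v" if "e \<in> incident_edges E v" for e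
    using that card_edge[of e]
    by (auto simp: incident_edges_def neighbours_def card_2_iff insert_commute)
  then show "bij_betw (\<lambda>w. {v, w}) (neighbours E v) (incident_edges E v)"
    by (auto simp: bij_betw_def inj_on_def doubleton_eq_iff neighbours_def incident_edges_def)
qed

lemma incident_edges_Int:
  assumes "v \<noteq> w"
  shows "incident_edges E v \<inter> incident_edges E w \<subseteq> {{v, w}}"
proof
  fix e assume "e \<in> incident_edges E v \<inter> incident_edges E w"
  then have "card e = 2" "v \<in> e" "w \<in> e"
    using card_edge by (auto simp: incident_edges_def)
  then show "e \<in> {{v, w}}"
    using assms by (auto simp: card_2_iff)
qed

lemma incident_edges_disjoint:
  assumes "v \<noteq> w" "w \<notin> neighbours E v"
  shows "incident_edges E v \<inter> incident_edges E w = {}"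
  using incident_edges_Int[OF assms(1)] assms(2) incident_edges_subset[of E v]
  unfolding neighbours_def by blast

lemma all_linked_imp_not_isolated:
  assumes "all_linked V F" "F \<subseteq> E" "u \<in> V" "v \<in> V" "u \<noteq> v"
  shows "\<not> isolated F u"
proof -
  have "linked F u v"
    using assms by (simp add: all_linked_def)
  then obtain w where "{u, w} \<in> F"
    using assms(5) by (auto simp: linked_def elim: converse_rtranclE)
  then show ?thesis
    using assms(2) by (auto simp: isolated_def incident_edges_def)
qed

end

locale regular_graph = finite_graph +
  fixes d :: nat
  assumes card_incident_edges: "v \<in> V \<Longrightarrow> card (incident_edges E v) = d"
begin

definition poor :: "'a set set \<Rightarrow> 'a \<Rightarrow> bool" where
  "poor F v \<longleftrightarrow> 3 * d < 4 * card (incident_edges E v - F)"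

definition adjacent_poor :: "'a set set set" where
  "adjacent_poor = {F. \<exists>v\<in>V. \<exists>w\<in>neighbours E v. poor F v \<and> poor F w}"

lemma card_neighbours_eq: "v \<in> V \<Longrightarrow> card (neighbours E v) = d"
  by (simp add: card_neighbours card_incident_edges)

lemma all_linked_imp_none_isolated:
  assumes "all_linked V F" "F \<subseteq> E" "0 < d"
  shows "F \<in> none_isolated V"
proof -
  have "\<not> isolated F v" if "v \<in> V" for v
  proof -
    have "neighbours E v \<noteq> {}"
      using card_neighbours_eq[OF that] assms(3) by auto
    then obtain w where "w \<in> V" "v \<noteq> w"
      using neighbours_subset not_neighbour_self by blast
    then show ?thesis
      using all_linked_imp_not_isolated[OF assms(1,2) that] by blast
  qed
  then show ?thesis
    by (simp add: none_isolated_def)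
qed

lemma card_incident_edges_Un:
  assumes "v \<in> V" "w \<in> V" "v \<noteq> w"
  shows "2 * d - 1 \<le> card (incident_edges E v \<union> incident_edges E w)"
  using card_Un_Int[OF finite_incident_edges finite_incident_edges, of v w]
    card_mono[OF _ incident_edges_Int[OF assms(3)]] card_incident_edges[OF assms(1)]
    card_incident_edges[OF assms(2)]
  by simp

lemma card_missing_if_both_poor:
  assumes "poor F v" "poor F w" "v \<noteq> w"
  shows "d + d div 4 \<le> card ((incident_edges E v \<union> incident_edges E w) - F)"
proof -
  let ?A = "incident_edges E v - F" and ?B = "incident_edges E w - F"
  have "card (?A \<inter> ?B) \<le> card {{v, w}}"
    using incident_edges_Int[OF assms(3)] by (intro card_mono) auto
  moreover have "card ?A + card ?B = card (?A \<union> ?B) + card (?A \<inter> ?B)"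
    using finite_incident_edges by (intro card_Un_Int) auto
  moreover have "?A \<union> ?B = (incident_edges E v \<union> incident_edges E w) - F"
    by auto
  ultimately show ?thesis
    using assms(1,2) unfolding poor_def by simp
qed

end

section \<open>Percolation on regular graphs\<close>

lemma power_one_minus_exp_approx:
  fixes x :: real
  assumes "0 \<le> x" "x \<le> 1"
  shows "\<bar>(1 - x) ^ N - exp (- (N * x))\<bar> \<le> N * x\<^sup>2"
proof -
  have "exp (- x) \<le> 1 / (1 + x)"
    using assms exp_ge_add_one_self[of x] by (simp add: exp_minus' frac_le)
  also have "\<dots> \<le> 1 - x + x\<^sup>2"
    using assms by (simp add: field_simps power2_eq_square)
  finally have "\<bar>(1 - x) - exp (- x)\<bar> \<le> x\<^sup>2"
    using exp_minus_ge[of x] by simp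
  then have "N * \<bar>(1 - x) - exp (- x)\<bar> \<le> N * x\<^sup>2"
    by (rule mult_left_mono) simp
  moreover have "\<bar>(1 - x) ^ N - exp (- x) ^ N\<bar> \<le> N * \<bar>(1 - x) - exp (- x)\<bar>"
    using assms norm_power_diff[of "1 - x" "exp (- x)" N] by simp
  moreover have "exp (- x) ^ N = exp (- (N * x))"
    by (simp flip: exp_of_nat_mult)
  ultimately show ?thesis
    by simp
qed

locale regular_percolation = regular_graph +
  fixes p :: real
  assumes p: "p \<in> {0..1}"
begin

abbreviation prob :: "'a set set set \<Rightarrow> real" where
  "prob \<equiv> measure_pmf.prob (random_subset E p)"

abbreviation q :: real where
  "q \<equiv> 1 - p"

lemma q_bounds: "0 \<le> q" "q \<le> 1"
  using p by auto

lemma prob_isolated: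
  assumes "v \<in> V"
  shows "prob {F. isolated F v} = q ^ d"
  using prob_random_subset_disjoint[OF finite_edges p incident_edges_subset]
  by (simp add: isolated_def card_incident_edges[OF assms])

lemma prob_both_isolated:
  assumes "v \<in> V" "w \<in> V" "v \<noteq> w"
  shows "prob {F. isolated F v \<and> isolated F w} \<le> q ^ (2 * d - 1)"
proof -
  let ?A = "incident_edges E v \<union> incident_edges E w"
  have "{F. isolated F v \<and> isolated F w} = {F. ?A \<inter> F = {}}"
    by (auto simp: isolated_def)
  then have "prob {F. isolated F v \<and> isolated F w} = q ^ card ?A"
    using prob_random_subset_disjoint[OF finite_edges p, of ?A] by simp
  also have "\<dots> \<le> q ^ (2 * d - 1)"
    using q_bounds card_incident_edges_Un[OF assms] by (intro power_decreasing)
  finally show ?thesis .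
qed

lemma prob_isolated_inter_none_isolated:
  assumes "v \<in> V" "v \<notin> U" "U \<inter> neighbours E v = {}"
  shows "prob ({F. isolated F v} \<inter> none_isolated U) = q ^ d * prob (none_isolated U)"
proof -
  have "isolated (F - incident_edges E v) u = isolated F u" if "u \<in> U" for u F
    using incident_edges_disjoint[of v u] that assms by (auto simp: isolated_def)
  then have "prob {F. incident_edges E v \<inter> F = {} \<and> (\<forall>u\<in>U. \<not> isolated F u)} =
      q ^ card (incident_edges E v) * prob {F. \<forall>u\<in>U. \<not> isolated F u}"
    using finite_edges p by (intro prob_random_subset_disjoint_inter) simp_all
  then show ?thesis
    using card_incident_edges[OF assms(1)]
    by (simp add: none_isolated_def isolated_def Collect_conj_eq)
qed

lemma prob_none_isolated_insert:
  "prob (none_isolated (insert v U)) =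
    prob (none_isolated U) - prob ({F. isolated F v} \<inter> none_isolated U)"
proof -
  have "none_isolated (insert v U) = none_isolated U - ({F. isolated F v} \<inter> none_isolated U)"
    by (auto simp: none_isolated_def)
  then show ?thesis
    by (simp add: measure_pmf.finite_measure_Diff)
qed

lemma prob_all_linked_le_none_isolated:
  assumes "0 < d" "U \<subseteq> V"
  shows "prob {F. all_linked V F} \<le> prob (none_isolated U)"
proof (rule prob_random_subset_mono)
  fix F assume "F \<subseteq> E" "F \<in> {F. all_linked V F}"
  then have "F \<in> none_isolated V"
    using assms(1) all_linked_imp_none_isolated by blast
  then show "F \<in> none_isolated U"
    using assms(2) by (auto simp: none_isolated_def)
qed

lemma prob_none_isolated_independent:
  assumes "finite U" "U \<subseteq> V" "\<And>u. u \<in> U \<Longrightarrow> U \<inter> neighbours E u = {}"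
  shows "prob (none_isolated U) = (1 - q ^ d) ^ card U"
  using assms
proof (induction U rule: finite_induct)
  case (insert v U)
  have "prob ({F. isolated F v} \<inter> none_isolated U) = q ^ d * prob (none_isolated U)"
    using insert.prems insert.hyps by (intro prob_isolated_inter_none_isolated) auto
  moreover have "prob (none_isolated U) = (1 - q ^ d) ^ card U"
    using insert.prems by (intro insert.IH) auto
  ultimately show ?case
    using insert.hyps by (simp add: prob_none_isolated_insert algebra_simps)
qed (simp add: none_isolated_def)

theorem prob_all_linked_le_if_bipartite:
  assumes colour: "\<And>u v. {u, v} \<in> E \<Longrightarrow> colour u \<noteq> (colour v :: bool)" and "0 < d"
  shows "prob {F. all_linked V F} \<le> exp (- (card V * q ^ d / 2))"
proof -
  have "card V = card {v \<in> V. colour v} + card {v \<in> V. \<not> colour v}"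
    using finite_verts by (subst card_Un_disjoint[symmetric]) (auto intro: arg_cong[where f = card])
  then have "card V \<le> 2 * card {v \<in> V. colour v = True} \<or>
      card V \<le> 2 * card {v \<in> V. colour v = False}"
    unfolding eq_True eq_False by linarith
  then obtain b where b: "card V \<le> 2 * card {v \<in> V. colour v = b}"
    by blast
  define U where "U = {v \<in> V. colour v = b}"
  have "prob {F. all_linked V F} \<le> prob (none_isolated U)"
    using \<open>0 < d\<close> by (intro prob_all_linked_le_none_isolated) (auto simp: U_def)
  also have "\<dots> = (1 - q ^ d) ^ card U"
    using finite_verts colour
    by (intro prob_none_isolated_independent) (auto simp: U_def neighbours_def)
  also have "\<dots> \<le> exp (- (q ^ d)) ^ card U"
    using q_bounds exp_minus_ge by (intro power_mono) (auto simp: power_le_one)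
  also have "\<dots> = exp (- (card U * q ^ d))"
    by (simp flip: exp_of_nat_mult)
  also have "\<dots> \<le> exp (- (card V * q ^ d / 2))"
  proof -
    have "real (card V) \<le> 2 * card U"
      using b unfolding U_def by linarith
    then have "card V * q ^ d \<le> 2 * card U * q ^ d"
      using q_bounds by (intro mult_right_mono) auto
    then show ?thesis
      by simp
  qed
  finally show ?thesis .
qed

lemma prob_ex_isolated_neighbour:
  assumes "v \<in> V"
  shows "prob {F. \<exists>w\<in>neighbours E v. isolated F w} \<le> d * q ^ d"
proof -
  have "prob (\<Union>w\<in>neighbours E v. {F. isolated F w}) \<le> card (neighbours E v) * q ^ d"
    using neighbours_subset prob_isolated by (intro prob_UNION_le_card finite_neighbours) force
  then show ?thesis
    unfolding card_neighbours_eq[OF assms] Collect_bex_eq .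
qed

lemma prob_isolated_ex_isolated_neighbour:
  assumes "v \<in> V"
  shows "prob {F. \<exists>w\<in>neighbours E v. isolated F v \<and> isolated F w} \<le> d * q ^ (2 * d - 1)"
proof -
  have "prob (\<Union>w\<in>neighbours E v. {F. isolated F v \<and> isolated F w}) \<le>
      card (neighbours E v) * q ^ (2 * d - 1)"
    using assms neighbours_subset not_neighbour_self
    by (intro prob_UNION_le_card finite_neighbours prob_both_isolated) blast+
  then show ?thesis
    unfolding card_neighbours_eq[OF assms] Collect_bex_eq .
qed

text \<open>Passing from \<open>U\<close> to \<open>U - neighbours E v\<close> changes the probabilities on both sides only if \<open>v\<close>
  has an isolated neighbour.\<close>

lemma prob_isolated_inter_none_isolated_approx:
  assumes v: "v \<in> V" and U: "v \<notin> U" "U \<subseteq> V"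
  shows "\<bar>prob ({F. isolated F v} \<inter> none_isolated U) - q ^ d * prob (none_isolated U)\<bar> \<le>
    d * q ^ (2 * d - 1)"
proof -
  let ?B = "{F. isolated F v}"
  define U' where "U' = U - neighbours E v"
  define D where "D = none_isolated U' - none_isolated U"
  have D: "D \<subseteq> {F. \<exists>w\<in>neighbours E v. isolated F w}"
    by (auto simp: D_def none_isolated_def U'_def)
  have union: "none_isolated U' = none_isolated U \<union> D" "none_isolated U \<inter> D = {}"
    by (auto simp: none_isolated_def D_def U'_def)
  have split: "prob (A \<inter> none_isolated U') = prob (A \<inter> none_isolated U) + prob (A \<inter> D)" for A
    unfolding union(1) Int_Un_distrib
    using union(2) by (intro measure_pmf.finite_measure_Union) auto
  have "prob (?B \<inter> none_isolated U') = q ^ d * prob (none_isolated U')"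
    using v U by (intro prob_isolated_inter_none_isolated) (auto simp: U'_def)
  then have diff: "prob (?B \<inter> none_isolated U) - q ^ d * prob (none_isolated U) =
      q ^ d * prob D - prob (?B \<inter> D)"
    using split[of ?B] split[of UNIV] by (simp add: distrib_left)
  have "prob D \<le> d * q ^ d"
    using D by (intro order_trans[OF _ prob_ex_isolated_neighbour[OF v]]
        measure_pmf.finite_measure_mono) auto
  then have "q ^ d * prob D \<le> q ^ d * (d * q ^ d)"
    using q_bounds by (intro mult_left_mono) auto
  also have "\<dots> = d * q ^ (2 * d)"
    by (simp add: mult_2 power_add)
  also have "\<dots> \<le> d * q ^ (2 * d - 1)"
    using q_bounds by (intro mult_left_mono power_decreasing) auto
  finally have "q ^ d * prob D \<le> d * q ^ (2 * d - 1)" .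
  moreover have "prob (?B \<inter> D) \<le> d * q ^ (2 * d - 1)"
    using D by (intro order_trans[OF _ prob_isolated_ex_isolated_neighbour[OF v]]
        measure_pmf.finite_measure_mono) auto
  moreover have "0 \<le> q ^ d * prob D" "0 \<le> prob (?B \<inter> D)"
    using q_bounds by auto
  ultimately show ?thesis
    unfolding diff by linarith
qed

lemma prob_none_isolated_approx:
  assumes "finite U" "U \<subseteq> V"
  shows "\<bar>prob (none_isolated U) - (1 - q ^ d) ^ card U\<bar> \<le> card U * (d * q ^ (2 * d - 1))"
  using assms
proof (induction U rule: finite_induct)
  case (insert v U)
  define \<epsilon> where "\<epsilon> = d * q ^ (2 * d - 1)"
  define err where "err = prob (none_isolated U) - (1 - q ^ d) ^ card U"
  define err_v where
    "err_v = prob ({F. isolated F v} \<inter> none_isolated U) - q ^ d * prob (none_isolated U)"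
  have q_power: "0 \<le> q ^ d" "q ^ d \<le> 1"
    using q_bounds by (auto simp: power_le_one)
  have "\<bar>err\<bar> \<le> card U * \<epsilon>"
    unfolding err_def \<epsilon>_def using insert.prems by (intro insert.IH) auto
  then have "\<bar>(1 - q ^ d) * err\<bar> \<le> 1 * (card U * \<epsilon>)"
    unfolding abs_mult using q_power by (intro mult_mono) auto
  moreover have "\<bar>err_v\<bar> \<le> \<epsilon>"
    unfolding err_v_def \<epsilon>_def
    using insert.prems insert.hyps by (intro prob_isolated_inter_none_isolated_approx) auto
  moreover have "prob (none_isolated (insert v U)) - (1 - q ^ d) ^ card (insert v U) =
      (1 - q ^ d) * err - err_v"
    using insert.hyps by (simp add: prob_none_isolated_insert err_def err_v_def algebra_simps)
  ultimately have "\<bar>prob (none_isolated (insert v U)) - (1 - q ^ d) ^ card (insert v U)\<bar> \<le>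
      card U * \<epsilon> + \<epsilon>"
    by linarith
  also have "\<dots> = card (insert v U) * \<epsilon>"
    using insert.hyps by (simp add: algebra_simps)
  finally show ?case
    unfolding \<epsilon>_def .
qed (simp add: none_isolated_def)

theorem prob_none_isolated_exp_approx:
  "\<bar>prob (none_isolated V) - exp (- (card V * q ^ d))\<bar> \<le>
    card V * q ^ d * (d * q ^ (d - 1) + q ^ d)"
proof -
  have "\<bar>prob (none_isolated V) - (1 - q ^ d) ^ card V\<bar> \<le> card V * (d * q ^ (2 * d - 1))"
    using finite_verts by (intro prob_none_isolated_approx) auto
  moreover have "\<bar>(1 - q ^ d) ^ card V - exp (- (card V * q ^ d))\<bar> \<le> card V * (q ^ d)\<^sup>2"
    using q_bounds by (intro power_one_minus_exp_approx) (auto simp: power_le_one)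
  moreover have "d * q ^ (2 * d - 1) = d * (q ^ d * q ^ (d - 1))"
    by (cases d) (simp_all add: mult_2 power_add)
  then have "card V * (d * q ^ (2 * d - 1)) + card V * (q ^ d)\<^sup>2 =
      card V * q ^ d * (d * q ^ (d - 1) + q ^ d)"
    by (simp only:) (simp add: power2_eq_square algebra_simps)
  ultimately show ?thesis
    by linarith
qed

lemma prob_adjacent_poor:
  "prob adjacent_poor \<le> card V * q ^ d * (d * (2 ^ (2 * d) * q ^ (d div 4)))"
proof -
  let ?I = "Sigma V (neighbours E)"
  let ?event = "\<lambda>(v, w). {F. poor F v \<and> poor F w}"
  have "prob (?event i) \<le> 2 ^ (2 * d) * q ^ (d + d div 4)" if mem: "i \<in> ?I" for i
  proof -
    obtain v w where i: "i = (v, w)" "v \<in> V" "w \<in> neighbours E v"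
      using mem by (rule SigmaE)
    then have w: "w \<in> V" "v \<noteq> w"
      using neighbours_subset not_neighbour_self by auto
    let ?A = "incident_edges E v \<union> incident_edges E w"
    have "prob (?event i) \<le> prob {F. d + d div 4 \<le> card (?A - F)}"
      using card_missing_if_both_poor w i by (intro measure_pmf.finite_measure_mono) auto
    also have "\<dots> \<le> 2 ^ (2 * d) * q ^ (d + d div 4)"
      using finite_edges p w i card_Un_le[of "incident_edges E v" "incident_edges E w"]
      by (intro prob_random_subset_card_Diff_ge) (auto simp: card_incident_edges mult_2)
    finally show ?thesis .
  qed
  moreover have "finite ?I"
    using finite_verts finite_neighbours by blast
  moreover have "adjacent_poor = (\<Union>i\<in>?I. ?event i)"
    by (auto simp: adjacent_poor_def)
  ultimately have "prob adjacent_poor \<le> card ?I * (2 ^ (2 * d) * q ^ (d + d div 4))"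
    by (simp only: prob_UNION_le_card)
  also have "card ?I = card V * d"
    using finite_verts finite_neighbours by (simp add: card_SigmaI card_neighbours_eq)
  finally show ?thesis
    by (simp add: power_add mult_ac)
qed

end

section \<open>The permutahedron\<close>

text \<open>Index \<open>0\<close> stands for the identity: a walk may then stay put, and adjacent vertices can be
  treated like vertices with a common neighbour.\<close>

definition adj_swap :: "nat \<Rightarrow> nat \<Rightarrow> nat" where
  "adj_swap i = (if i = 0 then id else Transposition.transpose i (i + 1))"

definition perm_edge :: "(nat \<Rightarrow> nat) \<Rightarrow> nat \<Rightarrow> (nat \<Rightarrow> nat) set" where
  "perm_edge \<pi> i = {\<pi>, adj_swap i \<circ> \<pi>}"

definition far :: "nat \<Rightarrow> nat \<Rightarrow> bool" where
  "far i k \<longleftrightarrow> i + 1 < k \<or> k + 1 < i"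

lemma adj_swap_0 [simp]: "adj_swap 0 = id"
  by (simp add: adj_swap_def)

lemma adj_swap_involutory [simp]: "adj_swap i (adj_swap i x) = x"
  by (simp add: adj_swap_def)

lemma adj_swap_comp_involutory [simp]: "adj_swap i \<circ> (adj_swap i \<circ> \<pi>) = \<pi>"
  by (simp add: fun_eq_iff)

lemma adj_swap_commute: "far i k \<Longrightarrow> adj_swap i (adj_swap k x) = adj_swap k (adj_swap i x)"
  by (auto simp: far_def adj_swap_def Transposition.transpose_def)

lemma adj_swap_eq_Suc_iff: "adj_swap i x = x + 1 \<longleftrightarrow> i \<noteq> 0 \<and> x = i"
  by (auto simp: adj_swap_def Transposition.transpose_def)

lemma adj_swap_comp_eq_Suc_iff:
  assumes "i \<noteq> 0" "k \<noteq> 0" "far i k"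
  shows "adj_swap k (adj_swap i x) = x + 1 \<longleftrightarrow> x \<in> {i, k}"
  using assms by (auto simp: far_def adj_swap_def Transposition.transpose_def)

lemma inj_adj_swap: "inj adj_swap"
proof (rule injI)
  fix i j assume "adj_swap i = adj_swap j"
  then have "i \<noteq> 0 \<and> x = i \<longleftrightarrow> j \<noteq> 0 \<and> x = j" for x
    by (metis adj_swap_eq_Suc_iff)
  then show "i = j"
    by metis
qed

lemma adj_swap_comp_eq_imp:
  assumes "i \<noteq> 0" "k \<noteq> 0" "far i k" "i' \<noteq> 0" "k' \<noteq> 0" "far i' k'"
    and eq: "adj_swap k \<circ> adj_swap i = adj_swap k' \<circ> adj_swap i'"
  shows "(i', k') \<in> {(i, k), (k, i)}"
proof -
  have "x \<in> {i, k} \<longleftrightarrow> x \<in> {i', k'}" for x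
    using fun_cong[OF eq, of x] adj_swap_comp_eq_Suc_iff[OF assms(1-3), of x]
      adj_swap_comp_eq_Suc_iff[OF assms(4-6), of x] by simp
  then have "{i, k} = {i', k'}"
    by blast
  then show ?thesis
    by (auto simp: doubleton_eq_iff)
qed

lemma permutes_adj_swap: "i \<le> n \<Longrightarrow> adj_swap i permutes {1..n + 1}"
  by (auto simp: adj_swap_def permutes_id intro!: permutes_swap_id)

lemma permutes_induct_adj_swap [consumes 1, case_names id swap]:
  assumes "\<pi> permutes {1..n + 1}" "P id"
    and swap: "\<And>i \<pi>. i \<in> {1..n} \<Longrightarrow> \<pi> permutes {1..n + 1} \<Longrightarrow> P \<pi> \<Longrightarrow> P (adj_swap i \<circ> \<pi>)"
  shows "P \<pi>"
proof -
  have swaps: "P (apply_adj_transps is \<circ> \<pi>) \<and> apply_adj_transps is \<circ> \<pi> permutes {1..n + 1}"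
    if "set is \<subseteq> {1..n}" "\<pi> permutes {1..n + 1}" "P \<pi>" for "is" \<pi>
    using that(1)
  proof (induction "is")
    case (Cons i "is")
    have "adj_swap i = Transposition.transpose i (i + 1)"
      using Cons.prems by (simp add: adj_swap_def)
    then show ?case
      using Cons swap[of i "apply_adj_transps is \<circ> \<pi>"]
        permutes_compose[OF _ permutes_adj_swap[of i n], of "apply_adj_transps is \<circ> \<pi>"]
      by (simp add: o_def)
  qed (use that in simp)
  have transpose: "P (Transposition.transpose a b \<circ> \<pi>)"
    if "a \<in> {1..n + 1}" "b \<in> {1..n + 1}" "a < b" "\<pi> permutes {1..n + 1}" "P \<pi>" for a b \<pi>
    using swaps[of "adj_transp_seq a b" \<pi>] that
    by (simp add: adj_transp_seq_correct set_adj_transp_seq subset_eq)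
  from assms(1) finite_atLeastAtMost assms(2) show ?thesis
  proof (induction \<pi> rule: permutes_induct)
    case (swap a b \<pi>)
    then show ?case
      using transpose[of a b \<pi>] transpose[of b a \<pi>] 
      by (cases a b rule: linorder_cases) (auto simp: o_def transpose_commute[of a b])
  qed
qed

lemma adj_swap_comp_in_verts:
  "\<pi> \<in> permutahedron_verts n \<Longrightarrow> i \<le> n \<Longrightarrow> adj_swap i \<circ> \<pi> \<in> permutahedron_verts n"
  unfolding permutahedron_verts_def using permutes_adj_swap by (auto intro: permutes_compose)

lemma evenperm_adj_swap_comp:
  assumes "\<pi> \<in> permutahedron_verts n" "i \<noteq> 0"
  shows "evenperm (adj_swap i \<circ> \<pi>) \<longleftrightarrow> \<not> evenperm \<pi>"
proof -
  have "permutation \<pi>"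
    using assms(1) unfolding permutahedron_verts_def permutation_permutes by blast
  then show ?thesis
    using assms(2) by (auto simp: adj_swap_def evenperm_comp permutation_swap_id evenperm_swap)
qed

lemma comp_in_verts_cancel:
  assumes "\<pi> \<in> permutahedron_verts n" "f \<circ> \<pi> = g \<circ> \<pi>"
  shows "f = g"
  using assms permutes_surj[of \<pi> "{1..n + 1}"]
  unfolding permutahedron_verts_def by (metis mem_Collect_eq surj_fun_eq)

lemma permutahedron_edges_iff:
  "e \<in> permutahedron_edges n \<longleftrightarrow> (\<exists>\<pi>\<in>permutahedron_verts n. \<exists>i\<in>{1..n}. e = perm_edge \<pi> i)"
proof -
  have "perm_edge \<pi> i = {\<pi>, Transposition.transpose i (i + 1) \<circ> \<pi>}" if "i \<in> {1..n}" for \<pi> i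
    using that by (simp add: perm_edge_def adj_swap_def)
  then show ?thesis
    unfolding permutahedron_edges_def mem_Collect_eq by metis
qed

lemma perm_edge_in_edges:
  "\<pi> \<in> permutahedron_verts n \<Longrightarrow> i \<in> {1..n} \<Longrightarrow> perm_edge \<pi> i \<in> permutahedron_edges n"
  using permutahedron_edges_iff by blast

lemma perm_edge_0_notin_edges: "perm_edge \<pi> 0 \<notin> permutahedron_edges n"
  using permutahedron_edge(2)[of "perm_edge \<pi> 0" n] by (auto simp: perm_edge_def)

lemma perm_edge_adj_swap_comp: "perm_edge (adj_swap i \<circ> \<pi>) i = perm_edge \<pi> i"
  by (auto simp: perm_edge_def)

lemma perm_edge_eq_same_parity_imp:
  assumes "\<pi> \<in> permutahedron_verts n" "\<pi>' \<in> permutahedron_verts n"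
    and "evenperm \<pi> = evenperm \<pi>'" "i \<noteq> 0" "i' \<noteq> 0" "perm_edge \<pi> i = perm_edge \<pi>' i'"
  shows "\<pi> = \<pi>' \<and> i = i'"
proof -
  have "\<pi> \<noteq> adj_swap i' \<circ> \<pi>'"
    using evenperm_adj_swap_comp[OF assms(2,5)] assms(3) by auto
  then have "\<pi> = \<pi>'" "adj_swap i \<circ> \<pi> = adj_swap i' \<circ> \<pi>'"
    using assms(6) by (auto simp: perm_edge_def doubleton_eq_iff)
  then show ?thesis
    using comp_in_verts_cancel[OF assms(1)] injD[OF inj_adj_swap] by blast
qed

lemma evenperm_neq_if_edge:
  assumes "{u, v} \<in> permutahedron_edges n"
  shows "evenperm u \<noteq> evenperm v"
proof -
  obtain \<pi> i where "\<pi> \<in> permutahedron_verts n" "i \<in> {1..n}" "{u, v} = {\<pi>, adj_swap i \<circ> \<pi>}"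
    using assms unfolding permutahedron_edges_iff perm_edge_def by blast
  then show ?thesis
    using evenperm_adj_swap_comp[of \<pi> n i] by (auto simp: doubleton_eq_iff)
qed

lemma incident_edges_permutahedron:
  assumes "v \<in> permutahedron_verts n"
  shows "incident_edges (permutahedron_edges n) v = perm_edge v ` {1..n}"
proof -
  have "e \<in> perm_edge v ` {1..n}" if e: "e \<in> incident_edges (permutahedron_edges n) v" for e
  proof -
    obtain \<pi> i where i: "i \<in> {1..n}" and "e = perm_edge \<pi> i" "v \<in> perm_edge \<pi> i"
      using e unfolding incident_edges_def mem_Collect_eq permutahedron_edges_iff by blast
    then have "e = perm_edge v i"
      using perm_edge_adj_swap_comp[of i \<pi>] unfolding perm_edge_def by blast
    with i show ?thesis
      by blast
  qed
  then show ?thesis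
    using perm_edge_in_edges[OF assms] by (auto simp: incident_edges_def perm_edge_def)
qed

lemma inj_on_perm_edge: "v \<in> permutahedron_verts n \<Longrightarrow> inj_on (perm_edge v) {1..n}"
  using perm_edge_eq_same_parity_imp[of v n v] by (auto intro!: inj_onI)

interpretation perm: regular_graph "permutahedron_verts n" "permutahedron_edges n" n for n
proof
  show "card (incident_edges (permutahedron_edges n) v) = n" if "v \<in> permutahedron_verts n" for v
    using card_image[OF inj_on_perm_edge[OF that]]
    by (simp add: incident_edges_permutahedron[OF that])
qed (use finite_permutahedron_verts permutahedron_edge in auto)

lemma neighbours_permutahedron:
  assumes "v \<in> permutahedron_verts n" "i \<in> {1..n}"
  shows "adj_swap i \<circ> v \<in> neighbours (permutahedron_edges n) v"
  using perm_edge_in_edges[OF assms] by (simp add: neighbours_def perm_edge_def)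

lemma card_permutahedron_verts: "card (permutahedron_verts n) = fact (n + 1)"
  unfolding permutahedron_verts_def by (rule card_permutations) auto

lemma all_linked_permutahedronI:
  assumes "\<And>\<pi> i. \<pi> \<in> permutahedron_verts n \<Longrightarrow> i \<in> {1..n} \<Longrightarrow> linked F \<pi> (adj_swap i \<circ> \<pi>)"
  shows "all_linked (permutahedron_verts n) F"
proof -
  have "linked F id \<pi>" if "\<pi> permutes {1..n + 1}" for \<pi>
    using that
  proof (induction rule: permutes_induct_adj_swap)
    case (swap i \<pi>)
    then show ?case
      using assms[of \<pi> i] linked_trans[of F id \<pi>] unfolding permutahedron_verts_def by blast
  qed simp
  then show ?thesis
    unfolding all_linked_def permutahedron_verts_def by (blast intro: linked_sym linked_trans)
qed

section \<open>Detours\<close>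

text \<open>For \<open>v = \<tau>\<^sub>a x\<close>, \<open>w = \<tau>\<^sub>b x\<close> and indices \<open>i\<close>, \<open>k\<close> far from \<open>a\<close>, \<open>b\<close> and each other, the detour
  from \<open>v\<close> to \<open>w\<close> given by \<open>(i, k)\<close> is the walk
  \<open>v, \<tau>\<^sub>i v, \<tau>\<^sub>k \<tau>\<^sub>i v = \<tau>\<^sub>a y, y, \<tau>\<^sub>b y = \<tau>\<^sub>i \<tau>\<^sub>k w, \<tau>\<^sub>k w, w\<close> where \<open>y = \<tau>\<^sub>k \<tau>\<^sub>i x\<close>.\<close>

definition side_edge :: "(nat \<Rightarrow> nat) \<Rightarrow> nat \<times> nat \<Rightarrow> (nat \<Rightarrow> nat) set" where
  "side_edge v = (\<lambda>(i, k). perm_edge (adj_swap i \<circ> v) k)"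

definition middle_edge :: "(nat \<Rightarrow> nat) \<Rightarrow> nat \<Rightarrow> nat \<times> nat \<Rightarrow> (nat \<Rightarrow> nat) set" where
  "middle_edge x a = (\<lambda>(i, k). perm_edge (adj_swap k \<circ> (adj_swap i \<circ> x)) a)"

definition detour_edges :: "nat \<Rightarrow> (nat \<Rightarrow> nat) \<Rightarrow> nat \<Rightarrow> nat \<Rightarrow> (nat \<Rightarrow> nat) set set" where
  "detour_edges n x a b = permutahedron_edges n \<inter>
     (\<Union>f\<in>{side_edge (adj_swap a \<circ> x), side_edge (adj_swap b \<circ> x), middle_edge x a, middle_edge x b}.
       f ` ({1..n} \<times> {1..n}))"

definition detour_pairs :: "nat \<Rightarrow> nat \<Rightarrow> nat set \<Rightarrow> nat set \<Rightarrow> (nat \<times> nat) set" where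
  "detour_pairs a b I K =
     {(i, k). i \<in> I \<and> k \<in> K \<and> far i a \<and> far i b \<and> far k a \<and> far k b \<and> far k i}"

lemma finite_detour_edges: "finite (detour_edges n x a b)"
  using finite_permutahedron_edges by (simp add: detour_edges_def)

lemma card_detour_edges: "card (detour_edges n x a b) \<le> 4 * n\<^sup>2"
proof -
  let ?I = "{1..n} \<times> {1..n}"
  let ?fs = "{side_edge (adj_swap a \<circ> x), side_edge (adj_swap b \<circ> x),
    middle_edge x a, middle_edge x b}"
  have image: "card (f ` ?I) \<le> n\<^sup>2" for f :: "nat \<times> nat \<Rightarrow> (nat \<Rightarrow> nat) set"
    using card_image_le[of ?I f] by (simp add: power2_eq_square)
  have "card (detour_edges n x a b) \<le> card (\<Union>f\<in>?fs. f ` ?I)"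
    unfolding detour_edges_def by (intro card_mono) auto
  also have "\<dots> \<le> (\<Sum>f\<in>?fs. card (f ` ?I))"
    by (rule card_UN_le) simp
  also have "\<dots> \<le> of_nat (card ?fs) * n\<^sup>2"
    by (intro sum_bounded_above image)
  also have "\<dots> \<le> 4 * n\<^sup>2"
    by (intro mult_right_mono) (auto simp: card_insert_if)
  finally show ?thesis .
qed

lemma linked_adj_swap_comp:
  assumes "\<pi> \<in> permutahedron_verts n" "i \<le> n" "perm_edge \<pi> i \<notin> permutahedron_edges n - F"
  shows "linked F \<pi> (adj_swap i \<circ> \<pi>)"
proof (cases "i = 0")
  case False
  then have "perm_edge \<pi> i \<in> F"
    using assms perm_edge_in_edges[of \<pi> n i] by simp
  then show ?thesis
    unfolding perm_edge_def by (rule linked_edge)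
qed simp

lemma linked_detour:
  assumes x: "x \<in> permutahedron_verts n" and ab: "a \<le> n" "b \<le> n"
    and v: "v = adj_swap a \<circ> x" and w: "w = adj_swap b \<circ> x"
    and pair: "(i, k) \<in> detour_pairs a b {1..n} {1..n}"
    and kept: "perm_edge v i \<in> F" "perm_edge w k \<in> F"
    and side: "side_edge v (i, k) \<notin> permutahedron_edges n - F"
      "side_edge w (k, i) \<notin> permutahedron_edges n - F"
    and middle: "middle_edge x a (i, k) \<notin> permutahedron_edges n - F"
      "middle_edge x b (i, k) \<notin> permutahedron_edges n - F"
  shows "linked F v w"
proof -
  have far: "far i a" "far i b" "far k a" "far k b" "far k i" and ik: "i \<le> n" "k \<le> n"
    using pair by (auto simp: detour_pairs_def)
  define y where "y = adj_swap k \<circ> (adj_swap i \<circ> x)"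
  have verts: "v \<in> permutahedron_verts n" "w \<in> permutahedron_verts n" "y \<in> permutahedron_verts n"
    "adj_swap i \<circ> v \<in> permutahedron_verts n" "adj_swap k \<circ> w \<in> permutahedron_verts n"
    unfolding v w y_def using x ab ik by (simp_all only: adj_swap_comp_in_verts)
  have yv: "adj_swap k \<circ> (adj_swap i \<circ> v) = adj_swap a \<circ> y"
    using far adj_swap_commute[of i a] adj_swap_commute[of k a] by (simp add: y_def v fun_eq_iff)
  have yw: "adj_swap i \<circ> (adj_swap k \<circ> w) = adj_swap b \<circ> y"
    using far adj_swap_commute[of i b] adj_swap_commute[of k b] adj_swap_commute[of k i]
    by (simp add: y_def w fun_eq_iff)
  have "linked F v (adj_swap i \<circ> v)"
    using kept verts ik by (intro linked_adj_swap_comp) auto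
  also have "linked F (adj_swap i \<circ> v) (adj_swap a \<circ> y)"
    unfolding yv[symmetric] using side verts ik
    by (intro linked_adj_swap_comp) (auto simp: side_edge_def)
  also have "linked F (adj_swap a \<circ> y) y"
    using middle verts ab
    by (intro linked_sym[OF linked_adj_swap_comp]) (auto simp: middle_edge_def y_def)
  also have "linked F y (adj_swap b \<circ> y)"
    using middle verts ab by (intro linked_adj_swap_comp) (auto simp: middle_edge_def y_def)
  also have "linked F (adj_swap b \<circ> y) (adj_swap k \<circ> w)"
    unfolding yw[symmetric] using side verts ik
    by (intro linked_sym[OF linked_adj_swap_comp]) (auto simp: side_edge_def)
  also have "linked F (adj_swap k \<circ> w) w"
    using kept verts ik by (intro linked_sym[OF linked_adj_swap_comp]) auto
  finally show ?thesis .
qed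

lemma inj_on_side_edge:
  assumes "v \<in> permutahedron_verts n"
  shows "inj_on (side_edge v) ({1..n} \<times> {1..n})"
proof (rule inj_onI, clarify)
  fix i k i' k' assume ik: "i \<in> {1..n}" "k \<in> {1..n}" "i' \<in> {1..n}" "k' \<in> {1..n}"
    and "side_edge v (i, k) = side_edge v (i', k')"
  then have "adj_swap i \<circ> v = adj_swap i' \<circ> v \<and> k = k'"
    using assms by (intro perm_edge_eq_same_parity_imp[of _ n])
      (auto simp: side_edge_def adj_swap_comp_in_verts evenperm_adj_swap_comp)
  then show "i = i' \<and> k = k'"
    using comp_in_verts_cancel[OF assms] injD[OF inj_adj_swap] by blast
qed

lemma middle_edge_eq_imp:
  assumes x: "x \<in> permutahedron_verts n" and "a \<noteq> 0"
    and ik: "i \<in> {1..n}" "k \<in> {1..n}" "far i k"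
    and ik': "i' \<in> {1..n}" "k' \<in> {1..n}" "far i' k'"
    and eq: "middle_edge x a (i, k) = middle_edge x a (i', k')"
  shows "(i', k') \<in> {(i, k), (k, i)}"
proof -
  have "adj_swap k \<circ> (adj_swap i \<circ> x) = adj_swap k' \<circ> (adj_swap i' \<circ> x)"
  proof (rule perm_edge_eq_same_parity_imp[where i = a and i' = a, THEN conjunct1])
    have parity: "evenperm (adj_swap k \<circ> (adj_swap i \<circ> x)) = evenperm x"
      if "i \<in> {1..n}" "k \<in> {1..n}" for i k
      using x that by (simp add: evenperm_adj_swap_comp[where n = n] adj_swap_comp_in_verts)
    show "evenperm (adj_swap k \<circ> (adj_swap i \<circ> x)) = evenperm (adj_swap k' \<circ> (adj_swap i' \<circ> x))"
      using parity ik ik' by simp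
  qed (use assms in \<open>auto simp: middle_edge_def intro!: adj_swap_comp_in_verts\<close>)
  then have "(adj_swap k \<circ> adj_swap i) \<circ> x = (adj_swap k' \<circ> adj_swap i') \<circ> x"
    by (simp add: comp_assoc)
  then have "adj_swap k \<circ> adj_swap i = adj_swap k' \<circ> adj_swap i'"
    by (rule comp_in_verts_cancel[OF x])
  then show ?thesis
    using ik ik' by (intro adj_swap_comp_eq_imp) auto
qed

lemma card_le_twice_card_if_two_preimages:
  assumes "finite B" "f ` A \<subseteq> B"
    and preimages: "\<And>x y. x \<in> A \<Longrightarrow> y \<in> A \<Longrightarrow> f x = f y \<Longrightarrow> y \<in> {x, g x}"
  shows "card A \<le> 2 * card B"
proof -
  let ?rep = "inv_into A f"
  have "finite (f ` A)"
    using assms(1,2) by (rule finite_subset[rotated])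
  then have "finite (?rep ` f ` A)"
    by simp
  have "x \<in> ?rep ` f ` A \<union> g ` ?rep ` f ` A" if "x \<in> A" for x
    using preimages[of "?rep (f x)" x] that by (auto simp: inv_into_into f_inv_into_f)
  then have "card A \<le> card (?rep ` f ` A \<union> g ` ?rep ` f ` A)"
    using \<open>finite (f ` A)\<close> by (intro card_mono) auto
  also have "\<dots> \<le> card (?rep ` f ` A) + card (g ` ?rep ` f ` A)"
    by (rule card_Un_le)
  also have "\<dots> \<le> card (?rep ` f ` A) + card (?rep ` f ` A)"
    using \<open>finite (?rep ` f ` A)\<close> by (intro add_left_mono card_image_le)
  finally show ?thesis
    using card_image_le[OF \<open>finite (f ` A)\<close>, of ?rep] card_mono[OF assms(1,2)] by linarith
qed

lemma card_side_edge_pairs: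
  assumes "v \<in> permutahedron_verts n" "finite C"
  shows "card {p \<in> {1..n} \<times> {1..n}. side_edge v p \<in> C} \<le> card C"
  using assms(2) inj_on_subset[OF inj_on_side_edge[OF assms(1)]]
  by (intro card_inj_on_le[of "side_edge v"]) auto

lemma card_middle_edge_pairs:
  assumes x: "x \<in> permutahedron_verts n" and C: "finite C" "C \<subseteq> permutahedron_edges n"
  shows "card {p \<in> detour_pairs a' b' {1..n} {1..n}. middle_edge x a p \<in> C} \<le> 2 * card C"
    (is "card ?P \<le> _")
proof (cases "a = 0")
  case True
  then have "?P = {}"
    using C(2) perm_edge_0_notin_edges by (auto simp: middle_edge_def)
  then show ?thesis
    by (simp only: card.empty le0)
next
  case False
  show ?thesis
  proof (rule card_le_twice_card_if_two_preimages[OF C(1), where g = prod.swap])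
    fix p p' assume "p \<in> ?P" "p' \<in> ?P" and eq: "middle_edge x a p = middle_edge x a p'"
    moreover obtain i k i' k' where pairs: "p = (i, k)" "p' = (i', k')"
      by (cases p, cases p')
    ultimately have "i \<in> {1..n}" "k \<in> {1..n}" "far i k" "i' \<in> {1..n}" "k' \<in> {1..n}" "far i' k'"
      by (auto simp: detour_pairs_def far_def)
    then show "p' \<in> {p, prod.swap p}"
      using middle_edge_eq_imp[OF x False] eq by (simp add: pairs)
  qed auto
qed

lemma card_far_ge: "card A \<le> card {i \<in> A. far i a} + 3"
proof (cases "finite A")
  case True
  have "card A = card ({i \<in> A. far i a} \<union> {i \<in> A. \<not> far i a})"
    by (rule arg_cong[where f = card]) auto
  also have "\<dots> \<le> card {i \<in> A. far i a} + card {i \<in> A. \<not> far i a}"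
    by (rule card_Un_le)
  also have "card {i \<in> A. \<not> far i a} \<le> card {a - 1, a, a + 1}"
    by (intro card_mono) (auto simp: far_def)
  also have "\<dots> \<le> 3"
    by (simp add: card_insert_if)
  finally show ?thesis
    by simp
qed simp

lemma card_detour_pairs:
  assumes "finite I" "finite K"
  shows "(card I - 6) * (card K - 9) \<le> card (detour_pairs a b I K)"
proof -
  let ?I = "{i \<in> {i \<in> I. far i a}. far i b}"
  let ?K = "\<lambda>i. {k \<in> {k \<in> {k \<in> K. far k a}. far k b}. far k i}"
  have I: "card I - 6 \<le> card ?I"
    using card_far_ge[of I a] card_far_ge[of "{i \<in> I. far i a}" b] by linarith
  have K: "card K - 9 \<le> card (?K i)" for i
    using card_far_ge[of K a] card_far_ge[of "{k \<in> K. far k a}" b]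
      card_far_ge[of "{k \<in> {k \<in> K. far k a}. far k b}" i] by linarith
  have "(card I - 6) * (card K - 9) \<le> card ?I * (card K - 9)"
    using I by simp
  also have "\<dots> \<le> (\<Sum>i\<in>?I. card (?K i))"
    using K sum_bounded_below[of ?I "card K - 9" "\<lambda>i. card (?K i)"] by simp
  also have "\<dots> = card (Sigma ?I ?K)"
    using assms by (subst card_SigmaI) auto
  also have "Sigma ?I ?K = detour_pairs a b I K"
    by (auto simp: detour_pairs_def)
  finally show ?thesis .
qed

definition blocked_pairs ::
    "nat \<Rightarrow> (nat \<Rightarrow> nat) \<Rightarrow> nat \<Rightarrow> nat \<Rightarrow> (nat \<Rightarrow> nat) set set \<Rightarrow> (nat \<times> nat) set" where
  "blocked_pairs n x a b C =
     {p \<in> {1..n} \<times> {1..n}. side_edge (adj_swap a \<circ> x) p \<in> C} \<union>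
     prod.swap ` {p \<in> {1..n} \<times> {1..n}. side_edge (adj_swap b \<circ> x) p \<in> C} \<union>
     {p \<in> detour_pairs a b {1..n} {1..n}. middle_edge x a p \<in> C} \<union>
     {p \<in> detour_pairs a b {1..n} {1..n}. middle_edge x b p \<in> C}"

lemma card_blocked_pairs:
  assumes x: "x \<in> permutahedron_verts n" and ab: "a \<le> n" "b \<le> n"
    and C: "finite C" "C \<subseteq> permutahedron_edges n"
  shows "card (blocked_pairs n x a b C) \<le> 6 * card C"
proof -
  let ?I = "{1..n} \<times> {1..n}" and ?D = "detour_pairs a b {1..n} {1..n}"
  have verts: "adj_swap a \<circ> x \<in> permutahedron_verts n" "adj_swap b \<circ> x \<in> permutahedron_verts n"
    using x ab by (simp_all add: adj_swap_comp_in_verts)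
  have "card (blocked_pairs n x a b C) \<le> card {p \<in> ?I. side_edge (adj_swap a \<circ> x) p \<in> C} +
      card (prod.swap ` {p \<in> ?I. side_edge (adj_swap b \<circ> x) p \<in> C}) +
      card {p \<in> ?D. middle_edge x a p \<in> C} + card {p \<in> ?D. middle_edge x b p \<in> C}"
    unfolding blocked_pairs_def by (meson add_le_mono1 card_Un_le le_trans)
  also have "\<dots> \<le> card C + card C + 2 * card C + 2 * card C"
    using card_side_edge_pairs[OF verts(1) C(1)] card_side_edge_pairs[OF verts(2) C(1)]
      card_middle_edge_pairs[OF x C]
    by (intro add_mono) (simp_all add: card_image)
  finally show ?thesis
    by simp
qed

lemma ex_unblocked_pair:
  assumes x: "x \<in> permutahedron_verts n" and ab: "a \<le> n" "b \<le> n"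
    and P: "P \<subseteq> detour_pairs a b {1..n} {1..n}"
    and few: "6 * card (detour_edges n x a b - F) < card P"
  obtains i k where "(i, k) \<in> P"
    "side_edge (adj_swap a \<circ> x) (i, k) \<notin> permutahedron_edges n - F"
    "side_edge (adj_swap b \<circ> x) (k, i) \<notin> permutahedron_edges n - F"
    "middle_edge x a (i, k) \<notin> permutahedron_edges n - F"
    "middle_edge x b (i, k) \<notin> permutahedron_edges n - F"
proof -
  define C where "C = detour_edges n x a b - F"
  have C: "finite C" "C \<subseteq> permutahedron_edges n"
    using finite_detour_edges by (auto simp: C_def detour_edges_def)
  have D: "detour_pairs a b {1..n} {1..n} \<subseteq> {1..n} \<times> {1..n}"
    by (auto simp: detour_pairs_def)
  then have "finite (detour_pairs a b {1..n} {1..n})"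
    by (rule finite_subset) simp
  then have "finite (blocked_pairs n x a b C)"
    by (simp add: blocked_pairs_def)
  moreover have "card (blocked_pairs n x a b C) < card P"
    using card_blocked_pairs[OF x ab C] few by (simp add: C_def)
  ultimately have "\<not> P \<subseteq> blocked_pairs n x a b C"
    using card_mono[of "blocked_pairs n x a b C" P] by linarith
  then obtain i k where ik: "(i, k) \<in> P" "(i, k) \<notin> blocked_pairs n x a b C"
    by auto
  moreover have "i \<in> {1..n}" "k \<in> {1..n}" "(i, k) \<in> detour_pairs a b {1..n} {1..n}"
    using ik(1) P D by auto
  ultimately have "side_edge (adj_swap a \<circ> x) (i, k) \<notin> C" "side_edge (adj_swap b \<circ> x) (k, i) \<notin> C"
    "middle_edge x a (i, k) \<notin> C" "middle_edge x b (i, k) \<notin> C"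
    unfolding blocked_pairs_def by (auto simp: image_iff)
  with ik(1) \<open>i \<in> {1..n}\<close> \<open>k \<in> {1..n}\<close> show ?thesis
    by (intro that[of i k]) (auto simp: C_def detour_edges_def)
qed

definition kept_indices :: "nat \<Rightarrow> (nat \<Rightarrow> nat) set set \<Rightarrow> (nat \<Rightarrow> nat) \<Rightarrow> nat set" where
  "kept_indices n F v = {i \<in> {1..n}. perm_edge v i \<in> F}"

lemma card_kept_indices:
  assumes "v \<in> permutahedron_verts n" "\<not> perm.poor n F v"
  shows "n \<le> 4 * card (kept_indices n F v)"
proof -
  have "incident_edges (permutahedron_edges n) v - F = perm_edge v ` ({1..n} - kept_indices n F v)"
    unfolding incident_edges_permutahedron[OF assms(1)] by (auto simp: kept_indices_def)
  moreover have "inj_on (perm_edge v) ({1..n} - kept_indices n F v)"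
    using inj_on_perm_edge[OF assms(1)] by (rule inj_on_subset) auto
  moreover have "card ({1..n} - kept_indices n F v) = n - card (kept_indices n F v)"
    by (subst card_Diff_subset) (auto simp: kept_indices_def)
  ultimately show ?thesis
    using assms(2) by (simp add: perm.poor_def card_image)
qed

lemma linked_if_not_poor:
  assumes x: "x \<in> permutahedron_verts n" and ab: "a \<le> n" "b \<le> n"
    and not_poor: "\<not> perm.poor n F (adj_swap a \<circ> x)" "\<not> perm.poor n F (adj_swap b \<circ> x)"
    and few: "384 * card (detour_edges n x a b - F) < n\<^sup>2" and n: "72 \<le> n"
  shows "linked F (adj_swap a \<circ> x) (adj_swap b \<circ> x)"
proof -
  let ?v = "adj_swap a \<circ> x" and ?w = "adj_swap b \<circ> x"
  let ?P = "detour_pairs a b (kept_indices n F ?v) (kept_indices n F ?w)"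
  have "n \<le> 4 * card (kept_indices n F ?v)" "n \<le> 4 * card (kept_indices n F ?w)"
    using x ab not_poor by (simp_all add: card_kept_indices adj_swap_comp_in_verts)
  then have "n\<^sup>2 \<le> (8 * (card (kept_indices n F ?v) - 6)) * (8 * (card (kept_indices n F ?w) - 9))"
    unfolding power2_eq_square using n by (intro mult_mono) auto
  also have "\<dots> \<le> 64 * card ?P"
    using card_detour_pairs[of "kept_indices n F ?v" "kept_indices n F ?w" a b]
    by (simp add: kept_indices_def)
  finally have "6 * card (detour_edges n x a b - F) < card ?P"
    using few by linarith
  moreover have P: "?P \<subseteq> detour_pairs a b {1..n} {1..n}"
    by (auto simp: detour_pairs_def kept_indices_def)
  ultimately obtain i k where ik: "(i, k) \<in> ?P"
    and unblocked: "side_edge ?v (i, k) \<notin> permutahedron_edges n - F"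
      "side_edge ?w (k, i) \<notin> permutahedron_edges n - F"
      "middle_edge x a (i, k) \<notin> permutahedron_edges n - F"
      "middle_edge x b (i, k) \<notin> permutahedron_edges n - F"
    using ex_unblocked_pair[OF x ab, of ?P F] by blast
  then have "perm_edge ?v i \<in> F" "perm_edge ?w k \<in> F"
    by (auto simp: detour_pairs_def kept_indices_def)
  then show ?thesis
    using P ik unblocked by (intro linked_detour[OF x ab refl refl]) auto
qed

definition blocked_detours :: "nat \<Rightarrow> (nat \<Rightarrow> nat) set set set" where
  "blocked_detours n = (\<Union>(x, a, b)\<in>permutahedron_verts n \<times> {..n} \<times> {..n}.
     {F. n\<^sup>2 \<le> 384 * card (detour_edges n x a b - F)})"

lemma linked_if_not_poor_not_blocked:
  assumes "72 \<le> n" "F \<notin> blocked_detours n" "x \<in> permutahedron_verts n" "a \<le> n" "b \<le> n"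
    and "\<not> perm.poor n F (adj_swap a \<circ> x)" "\<not> perm.poor n F (adj_swap b \<circ> x)"
  shows "linked F (adj_swap a \<circ> x) (adj_swap b \<circ> x)"
  using assms unfolding blocked_detours_def by (intro linked_if_not_poor) (auto simp: not_le)

lemma linked_neighbour_if_poor:
  assumes n: "72 \<le> n" and u: "u \<in> permutahedron_verts n" and i: "i \<in> {1..n}"
    and poor: "perm.poor n F u" and not_isolated: "\<not> perm.isolated n F u"
    and adjacent: "F \<notin> perm.adjacent_poor n" and detours: "F \<notin> blocked_detours n"
  shows "linked F u (adj_swap i \<circ> u)"
proof -
  have not_poor: "\<not> perm.poor n F (adj_swap k \<circ> u)" if "k \<in> {1..n}" for k
    using adjacent neighbours_permutahedron[OF u that] u poor by (auto simp: perm.adjacent_poor_def)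
  have "incident_edges (permutahedron_edges n) u \<inter> F \<noteq> {}"
    using not_isolated by (simp add: perm.isolated_def)
  then obtain a where a: "a \<in> {1..n}" "perm_edge u a \<in> F"
    unfolding incident_edges_permutahedron[OF u] by blast
  then have "linked F u (adj_swap a \<circ> u)"
    using u by (intro linked_adj_swap_comp) auto
  also have "linked F (adj_swap a \<circ> u) (adj_swap i \<circ> u)"
    using u i a(1) by (intro linked_if_not_poor_not_blocked[OF n detours] not_poor) simp_all
  finally show ?thesis .
qed

lemma all_linked_if_no_obstruction:
  assumes n: "72 \<le> n" and iso: "F \<in> perm.none_isolated n (permutahedron_verts n)"
    and no_obstruction: "F \<notin> perm.adjacent_poor n" "F \<notin> blocked_detours n"
  shows "all_linked (permutahedron_verts n) F"
proof (rule all_linked_permutahedronI)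
  have linked_poor: "linked F u (adj_swap i \<circ> u)"
    if "u \<in> permutahedron_verts n" "i \<in> {1..n}" "perm.poor n F u" for u i
    using that iso
    by (intro linked_neighbour_if_poor[OF n _ _ _ _ no_obstruction])
      (auto simp: perm.none_isolated_def)
  fix u i assume u: "u \<in> permutahedron_verts n" and i: "i \<in> {1..n}"
  let ?v = "adj_swap i \<circ> u"
  consider (poor_u) "perm.poor n F u" | (poor_v) "perm.poor n F ?v"
    | (not_poor) "\<not> perm.poor n F u" "\<not> perm.poor n F ?v"
    by blast
  then show "linked F u ?v"
  proof cases
    case poor_u
    then show ?thesis
      using linked_poor u i by blast
  next
    case poor_v
    then have "linked F ?v (adj_swap i \<circ> ?v)"
      using u i by (intro linked_poor) (auto intro: adj_swap_comp_in_verts)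
    then show ?thesis
      by (simp add: linked_sym)
  next
    case not_poor
    then show ?thesis
      using linked_if_not_poor_not_blocked[OF n no_obstruction(2) u, of 0 i] i by simp
  qed
qed

section \<open>Percolation on the permutahedron\<close>

definition prob_connected :: "nat \<Rightarrow> real \<Rightarrow> real" where
  "prob_connected n p = measure_pmf.prob (random_permutahedron n p)
     {G. Digraph_Component.connected (with_proj G)}"

lemma prob_connected_eq_prob_all_linked:
  "prob_connected n p =
   measure_pmf.prob (random_subset (permutahedron_edges n) p)
     {F. all_linked (permutahedron_verts n) F}"
proof -
  have "id \<in> permutahedron_verts n"
    by (simp add: permutahedron_verts_def permutes_id)
  then have "Digraph_Component.connected (with_proj
      (undirected_graph (permutahedron_verts n) {e \<in> permutahedron_edges n. keep e})) \<longleftrightarrow>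
      all_linked (permutahedron_verts n) {e \<in> permutahedron_edges n. keep e}" for keep
    using permutahedron_edge(1) by (intro connected_undirected_graph_iff) auto
  then show ?thesis
    by (simp add: prob_connected_def random_permutahedron_def random_subset_def vimage_def)
qed

lemma permutahedron_lambda_eq:
  fixes p :: real
  shows "permutahedron_lambda n p = card (permutahedron_verts n) * (1 - p) ^ n"
  unfolding permutahedron_lambda_def card_permutahedron_verts of_nat_fact ..

lemma regular_percolation_permutahedron:
  "p \<in> {0..1} \<Longrightarrow> regular_percolation (permutahedron_verts n) (permutahedron_edges n) n p"
  by unfold_locales

lemma prob_connected_le:
  assumes "p \<in> {0..1}" "1 \<le> n"
  shows "prob_connected n p \<le> exp (- (permutahedron_lambda n p / 2))"
proof -
  interpret regular_percolation "permutahedron_verts n" "permutahedron_edges n" n p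
    using assms(1) by (rule regular_percolation_permutahedron)
  show ?thesis
    unfolding permutahedron_lambda_eq prob_connected_eq_prob_all_linked
    using assms(2) by (intro prob_all_linked_le_if_bipartite[OF evenperm_neq_if_edge]) simp_all
qed

lemma prob_many_detour_edges_missing:
  assumes p: "p \<in> {0..1}" and n: "800 \<le> n"
  shows "measure_pmf.prob (random_subset (permutahedron_edges n) p)
      {F. n\<^sup>2 \<le> 384 * card (detour_edges n x a b - F)} \<le>
    2 ^ (4 * n\<^sup>2) * (1 - p) ^ (n + n\<^sup>2 div 800)"
proof -
  let ?P = "measure_pmf.prob (random_subset (permutahedron_edges n) p)"
  let ?m = "n + n\<^sup>2 div 800"
  have "800 * n \<le> n\<^sup>2" "800 * (n\<^sup>2 div 800) \<le> n\<^sup>2"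
    using n by (simp_all add: power2_eq_square)
  then have "384 * ?m \<le> n\<^sup>2"
    by simp
  then have "?m \<le> c" if "n\<^sup>2 \<le> 384 * c" for c
    using order_trans[OF _ that, of "384 * ?m"] by simp
  then have "?P {F. n\<^sup>2 \<le> 384 * card (detour_edges n x a b - F)} \<le>
      ?P {F. ?m \<le> card (detour_edges n x a b - F)}"
    by (intro measure_pmf.finite_measure_mono) auto
  also have "\<dots> \<le> 2 ^ (4 * n\<^sup>2) * (1 - p) ^ ?m"
    using finite_permutahedron_edges p card_detour_edges
    by (intro prob_random_subset_card_Diff_ge) (auto simp: detour_edges_def)
  finally show ?thesis .
qed

lemma prob_blocked_detours:
  assumes "p \<in> {0..1}" "800 \<le> n"
  shows "measure_pmf.prob (random_subset (permutahedron_edges n) p) (blocked_detours n) \<le>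
    permutahedron_lambda n p * ((real n + 1)\<^sup>2 * (2 ^ (4 * n\<^sup>2) * (1 - p) ^ (n\<^sup>2 div 800)))"
proof -
  let ?I = "permutahedron_verts n \<times> {..n} \<times> {..n}"
  have "measure_pmf.prob (random_subset (permutahedron_edges n) p) (blocked_detours n) \<le>
      card ?I * (2 ^ (4 * n\<^sup>2) * (1 - p) ^ (n + n\<^sup>2 div 800))"
    unfolding blocked_detours_def
    using finite_permutahedron_verts prob_many_detour_edges_missing[OF assms]
    by (intro prob_UNION_le_card) auto
  also have "real (card ?I) = card (permutahedron_verts n) * (real n + 1)\<^sup>2"
    by (simp add: card_cartesian_product power2_eq_square algebra_simps)
  finally show ?thesis
    by (simp add: permutahedron_lambda_eq power_add mult_ac)
qed

text \<open>The first two terms account for the Poisson approximation, the third one for adjacent poor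
  vertices and the last one for blocked detours.\<close>

definition connectivity_error :: "nat \<Rightarrow> real \<Rightarrow> real" where
  "connectivity_error n q = n * q ^ (n - 1) + q ^ n + n * (2 ^ (2 * n) * q ^ (n div 4)) +
     (real n + 1)\<^sup>2 * (2 ^ (4 * n\<^sup>2) * q ^ (n\<^sup>2 div 800))"

lemma prob_connected_approx:
  assumes p: "p \<in> {0..1}" and n: "800 \<le> n"
  shows "\<bar>prob_connected n p - exp (- permutahedron_lambda n p)\<bar> \<le>
    permutahedron_lambda n p * connectivity_error n (1 - p)"
proof -
  interpret regular_percolation "permutahedron_verts n" "permutahedron_edges n" n p
    using p by (rule regular_percolation_permutahedron)
  let ?linked = "{F. all_linked (permutahedron_verts n) F}"
  let ?none = "perm.none_isolated n (permutahedron_verts n)"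
  have "prob ?linked \<le> prob ?none"
    using n by (intro prob_all_linked_le_none_isolated) auto
  moreover have "prob ?none \<le> prob (?linked \<union> (perm.adjacent_poor n \<union> blocked_detours n))"
    using all_linked_if_no_obstruction[of n] n by (intro measure_pmf.finite_measure_mono) auto
  moreover have "prob (?linked \<union> (perm.adjacent_poor n \<union> blocked_detours n)) \<le>
      prob ?linked + (prob (perm.adjacent_poor n) + prob (blocked_detours n))"
    by (intro order_trans[OF measure_Un_le] add_left_mono measure_Un_le) auto
  moreover note prob_adjacent_poor prob_blocked_detours[OF p n] prob_none_isolated_exp_approx
  ultimately show ?thesis
    unfolding permutahedron_lambda_eq prob_connected_eq_prob_all_linked connectivity_error_def
      distrib_left
    by linarith
qed

section \<open>Limits\<close>

lemma two_power_mult_power_le_half_power: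
  fixes q :: real
  assumes "0 \<le> q" "q \<le> (1 / 2) ^ K" "a + b \<le> K * j"
  shows "2 ^ a * q ^ j \<le> (1 / 2) ^ b"
proof -
  have "q ^ j \<le> ((1 / 2) ^ K) ^ j"
    using assms by (intro power_mono)
  also have "\<dots> = (1 / 2) ^ (K * j)"
    by (simp only: power_mult)
  also have "\<dots> \<le> (1 / 2) ^ (a + b)"
    using assms(3) by (intro power_decreasing) auto
  finally have "2 ^ a * q ^ j \<le> 2 ^ a * (1 / 2) ^ (a + b)"
    by (rule mult_left_mono) simp
  then show ?thesis
    by (simp add: power_add power_one_over)
qed

lemma connectivity_error_le:
  assumes q: "0 \<le> q" "q \<le> (1 / 2) ^ 8000" and n: "1600 \<le> n"
  shows "connectivity_error n q \<le> 4 * ((real n + 1)\<^sup>2 * (1 / 2) ^ n)"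
proof -
  note small = two_power_mult_power_le_half_power[OF q]
  have "2 ^ 0 * q ^ (n - 1) \<le> (1 / 2) ^ n" "2 ^ 0 * q ^ n \<le> (1 / 2) ^ n"
    "2 ^ (2 * n) * q ^ (n div 4) \<le> (1 / 2) ^ n"
    using n by (intro small; simp)+
  moreover have "2 ^ (4 * n\<^sup>2) * q ^ (n\<^sup>2 div 800) \<le> (1 / 2) ^ n"
  proof (rule small)
    have "n \<le> n\<^sup>2"
      by (simp add: power2_eq_square)
    then show "4 * n\<^sup>2 + n \<le> 8000 * (n\<^sup>2 div 800)"
      using n by linarith
  qed
  moreover have "real n \<le> (real n + 1)\<^sup>2" "1 \<le> (real n + 1)\<^sup>2"
    by (simp_all add: power2_eq_square algebra_simps)
  ultimately have "n * q ^ (n - 1) \<le> (real n + 1)\<^sup>2 * (1 / 2) ^ n"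
    "1 * q ^ n \<le> (real n + 1)\<^sup>2 * (1 / 2) ^ n"
    "n * (2 ^ (2 * n) * q ^ (n div 4)) \<le> (real n + 1)\<^sup>2 * (1 / 2) ^ n"
    "(real n + 1)\<^sup>2 * (2 ^ (4 * n\<^sup>2) * q ^ (n\<^sup>2 div 800)) \<le> (real n + 1)\<^sup>2 * (1 / 2) ^ n"
    using q by (intro mult_mono; simp)+
  then show ?thesis
    unfolding connectivity_error_def by linarith
qed

lemma tendsto_connectivity_error:
  assumes "\<And>n. 0 \<le> q n" "q \<longlonglongrightarrow> 0"
  shows "(\<lambda>n. connectivity_error n (q n)) \<longlonglongrightarrow> 0"
proof (rule tendsto_sandwich)
  have "\<forall>\<^sub>F n in sequentially. q n < (1 / 2) ^ 8000"
    using assms(2) by (rule order_tendstoD(2)) (rule zero_less_power, simp)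
  then show "\<forall>\<^sub>F n in sequentially. connectivity_error n (q n) \<le> 4 * ((real n + 1)\<^sup>2 * (1 / 2) ^ n)"
    using eventually_ge_at_top[of 1600]
    by eventually_elim (rule connectivity_error_le[OF assms(1) less_imp_le])
  show "\<forall>\<^sub>F n in sequentially. 0 \<le> connectivity_error n (q n)"
    using assms(1) by (simp add: connectivity_error_def)
  show "(\<lambda>n. 4 * ((real n + 1)\<^sup>2 * (1 / 2) ^ n)) \<longlonglongrightarrow> 0"
    by real_asymp
qed simp

lemma tendsto_zero_if_fact_mult_power_bounded:
  fixes x :: "nat \<Rightarrow> real"
  assumes nonneg: "\<And>n. 0 \<le> x n" and bounded: "\<forall>\<^sub>F n in sequentially. fact n * x n ^ n \<le> L"
  shows "x \<longlonglongrightarrow> 0"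
proof (rule order_tendstoI)
  fix \<epsilon> :: real assume \<epsilon>: "0 < \<epsilon>"
  have "(\<lambda>n. inverse (fact n) * (1 / \<epsilon>) ^ n) \<longlonglongrightarrow> 0"
    using summable_LIMSEQ_zero[OF summable_exp[of "1 / \<epsilon>"]] .
  then have "(\<lambda>n. L * (inverse (fact n) * (1 / \<epsilon>) ^ n)) \<longlonglongrightarrow> L * 0"
    by (intro tendsto_intros)
  then have "\<forall>\<^sub>F n in sequentially. L * (inverse (fact n) * (1 / \<epsilon>) ^ n) < 1"
    by (rule order_tendstoD(2)) simp
  then show "\<forall>\<^sub>F n in sequentially. x n < \<epsilon>"
    using bounded
  proof eventually_elim
    case (elim n)
    show ?case
    proof (rule ccontr)
      assume "\<not> x n < \<epsilon>"
      then have "fact n * \<epsilon> ^ n \<le> fact n * x n ^ n"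
        using \<epsilon> by (intro mult_left_mono power_mono) auto
      also note elim(2)
      finally show False
        using elim(1) \<epsilon> by (simp add: field_simps power_divide)
    qed
  qed
next
  fix a :: real assume "a < 0"
  then have "a < x n" for n
    using nonneg[of n] by linarith
  then show "\<forall>\<^sub>F n in sequentially. a < x n"
    by simp
qed

theorem tendsto_prob_connected_if_lambda_at_top:
  assumes p: "\<And>n. p n \<in> {0..1}"
    and lim: "filterlim (\<lambda>n. permutahedron_lambda n (p n)) at_top sequentially"
  shows "(\<lambda>n. prob_connected n (p n)) \<longlonglongrightarrow> 0"
proof (rule Lim_null_comparison)
  show "\<forall>\<^sub>F n in sequentially.
      norm (prob_connected n (p n)) \<le> exp (- (permutahedron_lambda n (p n) / 2))"
    using eventually_ge_at_top[of 1]
  proof eventually_elim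
    case (elim n)
    have "0 \<le> prob_connected n (p n)"
      by (simp add: prob_connected_def)
    then show ?case
      using prob_connected_le[OF p elim] by simp
  qed
  have "((\<lambda>y::real. exp (- (y / 2))) \<longlongrightarrow> 0) at_top"
    by real_asymp
  then show "(\<lambda>n. exp (- (permutahedron_lambda n (p n) / 2))) \<longlonglongrightarrow> 0"
    using lim by (rule filterlim_compose)
qed

lemma one_minus_tendsto_zero_if_lambda_tendsto:
  assumes p: "\<And>n. p n \<in> {0..1}" and lim: "(\<lambda>n. permutahedron_lambda n (p n)) \<longlonglongrightarrow> c"
  shows "(\<lambda>n. 1 - p n) \<longlonglongrightarrow> 0"
proof (rule tendsto_zero_if_fact_mult_power_bounded)
  show "0 \<le> 1 - p n" for n
    using p[of n] by simp
  have "\<forall>\<^sub>F n in sequentially. permutahedron_lambda n (p n) < c + 1"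
    using lim by (rule order_tendstoD(2)) simp
  then show "\<forall>\<^sub>F n in sequentially. fact n * (1 - p n) ^ n \<le> c + 1"
  proof eventually_elim
    case (elim n)
    have "fact n * (1 - p n) ^ n \<le> permutahedron_lambda n (p n)"
      unfolding permutahedron_lambda_def using p[of n] by (intro mult_right_mono fact_mono) auto
    with elim show ?case
      by linarith
  qed
qed

theorem tendsto_prob_connected_if_lambda_tendsto:
  assumes p: "\<And>n. p n \<in> {0..1}" and lim: "(\<lambda>n. permutahedron_lambda n (p n)) \<longlonglongrightarrow> c"
  shows "(\<lambda>n. prob_connected n (p n)) \<longlonglongrightarrow> exp (- c)"
proof (rule Lim_transform)
  show "(\<lambda>n. exp (- permutahedron_lambda n (p n))) \<longlonglongrightarrow> exp (- c)"
    by (intro tendsto_intros lim)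
  show "(\<lambda>n. prob_connected n (p n) - exp (- permutahedron_lambda n (p n))) \<longlonglongrightarrow> 0"
  proof (rule Lim_null_comparison)
    show "\<forall>\<^sub>F n in sequentially.
        norm (prob_connected n (p n) - exp (- permutahedron_lambda n (p n))) \<le>
        permutahedron_lambda n (p n) * connectivity_error n (1 - p n)"
      unfolding real_norm_def using eventually_ge_at_top[of 800]
      by eventually_elim (rule prob_connected_approx[OF p])
    have "0 \<le> 1 - p n" for n
      using p[of n] by simp
    then have "(\<lambda>n. permutahedron_lambda n (p n) * connectivity_error n (1 - p n)) \<longlonglongrightarrow> c * 0"
      by (intro tendsto_mult lim tendsto_connectivity_error
          one_minus_tendsto_zero_if_lambda_tendsto[OF p lim])
    then show "(\<lambda>n. permutahedron_lambda n (p n) * connectivity_error n (1 - p n)) \<longlonglongrightarrow> 0"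
      by simp
  qed
qed

theorem theorem1p7:
  fixes p :: "nat \<Rightarrow> real"
  assumes "\<And>n. p n \<in> {0..1}"
  shows "(filterlim (\<lambda>n. permutahedron_lambda n (p n)) at_top sequentially \<longrightarrow>
            (\<lambda>n. measure_pmf.prob (random_permutahedron n (p n))
                   {G. Digraph_Component.connected (with_proj G)}) \<longlonglongrightarrow> 0) \<and>
         (\<forall>c\<ge>0. (\<lambda>n. permutahedron_lambda n (p n)) \<longlonglongrightarrow> c \<longrightarrow>
            (\<lambda>n. measure_pmf.prob (random_permutahedron n (p n))
                   {G. Digraph_Component.connected (with_proj G)}) \<longlonglongrightarrow> exp (- c))"
  using tendsto_prob_connected_if_lambda_at_top[where p = p, OF assms]
    tendsto_prob_connected_if_lambda_tendsto[where p = p, OF assms]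
  unfolding prob_connected_def by blast

end
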